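(* Let $F$ be an edge-ordered star forest with $k>1$ components. Then for every positive integer $n$, $$\mathrm{ex}_<(n,F)\le (k-1)\,\mathrm{ex}_{DS}(n,w'(F)).$$
   Context: Edge-ordered graph: finite simple graph with a linear order on its edges; isomorphisms preserve order; subgraphs carry induced order; $\mathrm{ex}_<(n,F)$ is the maximum number of edges of an edge-ordered graph on $n$ vertices with no subgraph isomorphic to $F$. A star forest is a non-empty graph all of whose components are stars. Words: a word is a finite sequence of letters. Words $a_1\dots a_n$ and $b_1\dots b_m$ are equivalent if $n=m$ and $a_i=a_j\iff b_i=b_j$ for all $i,j$. $|u|$ is the length and $\|u\|$ the number of distinct letters of $u$. $u$ is $k$-regular if every $k$ consecutive letters are distinct (if $|u|<k$, all letters distinct). A subword is obtained by deleting letters; $u$ contains $f$ if some subword of $u$ is equivalent to $f$, otherwise $u$ avoids $f$. For a non-empty word $f$, $\mathrm{ex}_{DS}(n,f)$ is the maximum length of an $\|f\|$-regular word $u$ with $\|u\|\le n$ avoiding $f$. For an edge-ordered star forest $F$ with $m$ edges, assign a distinct letter to each component; $w(F)=a_1\dots a_m$ where $a_i$ is the letter of the component containing the $i$-th smallest edge, and $w'(F)=a_1^{2m}\dots a_m^{2m}$ (each letter repeated $2m$ times). *)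

theory Defs
  imports Main "HOL-Library.Sublist"
begin

section \<open>Edge-ordered graphs\<close>

record 'v eograph =
  verts :: "'v set"
  edges :: "'v set set"
  eord :: "('v set \<times> 'v set) set"

definition edge_ordered_graph :: "'v eograph \<Rightarrow> bool" where
  "edge_ordered_graph G \<longleftrightarrow>
     finite (verts G) \<and>
     (\<forall>e\<in>edges G. e \<subseteq> verts G \<and> card e = 2) \<and>
     linear_order_on (edges G) (eord G)"

definition eo_subgraph :: "'v eograph \<Rightarrow> 'v eograph \<Rightarrow> bool" where
  "eo_subgraph H G \<longleftrightarrow>
     edge_ordered_graph H \<and>
     verts H \<subseteq> verts G \<and> edges H \<subseteq> edges G \<and>
     eord H = Restr (eord G) (edges H)"

definition eo_isomorphic :: "'v eograph \<Rightarrow> 'w eograph \<Rightarrow> bool" where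
  "eo_isomorphic G H \<longleftrightarrow>
     (\<exists>\<phi>. bij_betw \<phi> (verts G) (verts H) \<and>
          (\<lambda>e. \<phi> ` e) ` edges G = edges H \<and>
          (\<forall>e\<in>edges G. \<forall>e'\<in>edges G.
             (e, e') \<in> eord G \<longleftrightarrow> (\<phi> ` e, \<phi> ` e') \<in> eord H))"

definition eo_contains :: "'v eograph \<Rightarrow> 'w eograph \<Rightarrow> bool" where
  "eo_contains G F \<longleftrightarrow> (\<exists>H. eo_subgraph H G \<and> eo_isomorphic H F)"

text \<open>The set below is finite, and it is non-empty as soon as \<open>F\<close> has an edge. Since every finite
  graph is isomorphic to one with vertices in \<open>nat\<close>, the choice of vertex type is immaterial.\<close>

definition ex_lt :: "nat \<Rightarrow> 'v eograph \<Rightarrow> nat" where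
  "ex_lt n F = Max {card (edges G) | G :: nat eograph.
     edge_ordered_graph G \<and> card (verts G) = n \<and> \<not> eo_contains G F}"


section \<open>Components and star forests\<close>

definition component_of :: "'v eograph \<Rightarrow> 'v \<Rightarrow> 'v set" where
  "component_of G v = {w. (v, w) \<in> {(x, y). {x, y} \<in> edges G}\<^sup>*}"

definition components :: "'v eograph \<Rightarrow> 'v set set" where
  "components G = component_of G ` verts G"

definition is_star :: "'v set \<Rightarrow> 'v set set \<Rightarrow> bool" where
  "is_star C E \<longleftrightarrow> (\<exists>c\<in>C. E = (\<lambda>x. {c, x}) ` (C - {c}))"

text \<open>Non-empty means having at least one edge, so that the words attached to \<open>F\<close> below are
  non-empty. Isolated vertices are allowed, as degenerate stars.\<close>

definition edge_ordered_star_forest :: "'v eograph \<Rightarrow> bool" where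
  "edge_ordered_star_forest F \<longleftrightarrow>
     edge_ordered_graph F \<and> edges F \<noteq> {} \<and>
     (\<forall>C\<in>components F. is_star C {e \<in> edges F. e \<subseteq> C})"


section \<open>Words\<close>

definition word_equiv :: "'a list \<Rightarrow> 'b list \<Rightarrow> bool" where
  "word_equiv u v \<longleftrightarrow>
     length u = length v \<and>
     (\<forall>i<length u. \<forall>j<length u. u ! i = u ! j \<longleftrightarrow> v ! i = v ! j)"

definition num_letters :: "'a list \<Rightarrow> nat" where
  "num_letters u = card (set u)"

definition regular_word :: "nat \<Rightarrow> 'a list \<Rightarrow> bool" where
  "regular_word k u \<longleftrightarrow>
     (if length u < k then distinct u
      else \<forall>i. i + k \<le> length u \<longrightarrow> distinct (take k (drop i u)))"

definition word_contains :: "'a list \<Rightarrow> 'b list \<Rightarrow> bool" where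
  "word_contains u f \<longleftrightarrow> (\<exists>v. subseq v u \<and> word_equiv v f)"

text \<open>For non-empty \<open>f\<close> the set below contains \<open>0\<close>. It is finite by pigeonhole: in a long enough
  regular word over \<open>n\<close> letters, \<open>length f\<close> disjoint blocks of \<open>num_letters f\<close> consecutive letters
  use the same set of letters, which yields a copy of \<open>f\<close>.\<close>

definition ex_DS :: "nat \<Rightarrow> 'a list \<Rightarrow> nat" where
  "ex_DS n f = Max {length u | u :: nat list.
     regular_word (num_letters f) u \<and> num_letters u \<le> n \<and> \<not> word_contains u f}"


section \<open>The words of an edge-ordered star forest\<close>

definition edge_list :: "'v eograph \<Rightarrow> 'v set list" where
  "edge_list F = (THE es. distinct es \<and> set es = edges F \<and>
     sorted_wrt (\<lambda>e e'. (e, e') \<in> eord F) es)"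

definition edge_component :: "'v eograph \<Rightarrow> 'v set \<Rightarrow> 'v set" where
  "edge_component F e = (THE C. C \<in> components F \<and> e \<subseteq> C)"

text \<open>The letter assigned to a component is the component itself, as a set of vertices.\<close>

definition forest_word :: "'v eograph \<Rightarrow> 'v set list" where
  "forest_word F = map (edge_component F) (edge_list F)"

definition forest_word' :: "'v eograph \<Rightarrow> 'v set list" where
  "forest_word' F = concat (map (replicate (2 * card (edges F))) (forest_word F))"

end

theory Submission
  imports Defs "HOL-Library.FuncSet"
begin

text \<open>
  Scan the edges of an \<open>F\<close>-free graph \<open>G\<close> in increasing order and write a word \<open>u\<close> of vertices, with
  \<open>q\<close> the number of letters of \<open>w'(F)\<close>: an edge with an endpoint outside the last \<open>q - 1\<close> letters
  contributes such an endpoint, any other edge is skipped. The word is \<open>q\<close>-regular, and a skipped edge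
  joins two letters of \<open>u\<close> at distance at most \<open>q - 2\<close>, so \<open>G\<close> has at most
  \<open>(1 + (q - 2)) |u| \<le> (k - 1) |u|\<close> edges.

  If \<open>u\<close> contained \<open>w'(F)\<close>, its letters would be the centres of the stars. Each of the \<open>m\<close> runs
  provides \<open>2m\<close> edges at one centre, while at most \<open>m\<close> centres and fewer than \<open>m\<close> previously chosen
  leaves are forbidden as the other endpoint; so leaves can be chosen greedily, which embeds the
  non-trivial stars of \<open>F\<close> into \<open>G\<close>.

  Isolated vertices of \<open>F\<close> can be placed unless \<open>n\<close> is less than the number of vertices of \<open>F\<close>, which
  is at most \<open>m + k\<close>. In that case \<open>n choose 2\<close> is already small compared with the length of an
  explicit regular word in which no letter occurs \<open>2m\<close> times.
\<close>


subsection \<open>Sorted edge lists\<close>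

text \<open>Insertion sort: \<open>x\<close> goes between the listed elements below it and the
  others, which lie above it by totality.\<close>

lemma finite_linear_order_sorted_list:
  assumes "finite B" "B \<subseteq> A" "linear_order_on A r"
  shows "\<exists>es. distinct es \<and> set es = B \<and> sorted_wrt (\<lambda>x y. (x, y) \<in> r) es"
  using assms(1,2)
proof (induction B rule: finite_induct)
  case empty
  show ?case by simp
next
  case (insert x B)
  then obtain es where es: "distinct es" "set es = B" "sorted_wrt (\<lambda>x y. (x, y) \<in> r) es"
    by auto
  have tr: "trans r" and tot: "total_on A r"
    using assms(3) by (auto simp: order_on_defs)
  let ?P = "\<lambda>y. (y, x) \<in> r"
  let ?es = "filter ?P es @ x # filter (\<lambda>y. \<not> ?P y) es"
  have gt: "(x, z) \<in> r" if "z \<in> B" "\<not> ?P z" for z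
    using that insert tot unfolding total_on_def by (metis insert_subset subsetD)
  have "distinct ?es" "set ?es = insert x B"
    using es insert by auto
  moreover have "sorted_wrt (\<lambda>x y. (x, y) \<in> r) ?es"
    using es gt transD[OF tr, of _ x] by (auto simp: sorted_wrt_append sorted_wrt_filter)
  ultimately show ?case by blast
qed

text \<open>If the heads differed, each would occur later in the other list, contradicting
  antisymmetry. This makes the \<open>THE\<close> in \<open>edge_list\<close> well defined.\<close>

lemma sorted_wrt_antisym_unique:
  assumes "antisym r" "distinct xs" "distinct ys" "set xs = set ys"
    "sorted_wrt (\<lambda>x y. (x, y) \<in> r) xs" "sorted_wrt (\<lambda>x y. (x, y) \<in> r) ys"
  shows "xs = ys"
  using assms(2-)
proof (induction xs arbitrary: ys)
  case Nil
  then show ?case by simp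
next
  case (Cons x xs)
  then obtain y ys' where ys: "ys = y # ys'"
    by (cases ys) auto
  have "x = y"
  proof (rule ccontr)
    assume "x \<noteq> y"
    then have "x \<in> set ys'" "y \<in> set xs"
      using Cons.prems ys by auto
    then have "(y, x) \<in> r" "(x, y) \<in> r"
      using Cons.prems ys by auto
    with \<open>x \<noteq> y\<close> show False
      using assms(1) by (auto dest: antisymD)
  qed
  moreover have "xs = ys'"
    using Cons.prems \<open>x = y\<close> unfolding ys by (intro Cons.IH) (auto simp: insert_eq_iff)
  ultimately show ?case using ys by simp
qed

lemma edge_ordered_graph_finite_edges:
  assumes "edge_ordered_graph G"
  shows "finite (edges G)"
proof (rule finite_subset)
  show "edges G \<subseteq> Pow (verts G)"
    using assms by (auto simp: edge_ordered_graph_def)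
  show "finite (Pow (verts G))"
    using assms by (auto simp: edge_ordered_graph_def)
qed

lemma edge_list_sorted:
  assumes "edge_ordered_graph G"
  shows "distinct (edge_list G)" "set (edge_list G) = edges G"
    "sorted_wrt (\<lambda>e e'. (e, e') \<in> eord G) (edge_list G)"
proof -
  have lin: "linear_order_on (edges G) (eord G)"
    using assms by (simp add: edge_ordered_graph_def)
  then have "antisym (eord G)"
    by (simp add: order_on_defs)
  have "\<exists>es. distinct es \<and> set es = edges G \<and> sorted_wrt (\<lambda>e e'. (e, e') \<in> eord G) es"
    by (rule finite_linear_order_sorted_list[OF edge_ordered_graph_finite_edges[OF assms] order_refl lin])
  then have "\<exists>!es. distinct es \<and> set es = edges G \<and> sorted_wrt (\<lambda>e e'. (e, e') \<in> eord G) es"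
    by (rule ex_ex1I) (auto intro: sorted_wrt_antisym_unique[OF \<open>antisym (eord G)\<close>])
  from theI'[OF this] show "distinct (edge_list G)" "set (edge_list G) = edges G"
    "sorted_wrt (\<lambda>e e'. (e, e') \<in> eord G) (edge_list G)"
    by (simp_all add: edge_list_def)
qed

text \<open>Turns edge order into order of indices, the form in which the orders of \<open>F\<close>
  and \<open>G\<close> are compared later.\<close>

lemma edge_list_nth_order:
  assumes G: "edge_ordered_graph G" and "i < length (edge_list G)" "j < length (edge_list G)"
  shows "(edge_list G ! i, edge_list G ! j) \<in> eord G \<longleftrightarrow> i \<le> j"
proof -
  have lin: "linear_order_on (edges G) (eord G)"
    using G by (simp add: edge_ordered_graph_def)
  note el = edge_list_sorted[OF G]
  have lt: "(edge_list G ! i, edge_list G ! j) \<in> eord G" if "i < j" "j < length (edge_list G)" for i j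
    using el(3) that by (simp add: sorted_wrt_iff_nth_less)
  have ne: "edge_list G ! i \<noteq> edge_list G ! j" if "j < i"
    using el(1) that assms by (simp add: nth_eq_iff_index_eq)
  have "edge_list G ! i \<in> edges G"
    unfolding el(2)[symmetric] using assms(2) by (rule nth_mem)
  then have rf: "(edge_list G ! i, edge_list G ! i) \<in> eord G"
    using lin by (auto simp: order_on_defs refl_on_def)
  have as: "antisym (eord G)"
    using lin by (simp add: order_on_defs)
  consider "i < j" | "i = j" | "j < i" by linarith
  then show ?thesis
  proof cases
    case 1 then show ?thesis using lt assms by auto
  next
    case 2 then show ?thesis using rf by auto
  next
    case 3 then show ?thesis using lt[of j i] assms ne as by (auto dest: antisymD)
  qed
qed


subsection \<open>Subwords\<close>

lemma subseq_imp_strict_mono_index: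
  assumes "subseq v u"
  shows "\<exists>p. strict_mono_on {..<length v} p \<and> (\<forall>i<length v. p i < length u \<and> v ! i = u ! p i)"
  using assms
proof (induction rule: list_emb.induct)
  case (list_emb_Nil ys)
  show ?case by (auto simp: strict_mono_on_def)
next
  case (list_emb_Cons xs ys y)
  then obtain p where "strict_mono_on {..<length xs} p" "\<forall>i<length xs. p i < length ys \<and> xs ! i = ys ! p i"
    by auto
  then show ?case
    by (intro exI[of _ "Suc \<circ> p"]) (auto simp: strict_mono_on_def)
next
  case (list_emb_Cons2 x y xs ys)
  then obtain p where p: "strict_mono_on {..<length xs} p" "\<forall>i<length xs. p i < length ys \<and> xs ! i = ys ! p i"
    by auto
  then show ?case using list_emb_Cons2
    by (intro exI[of _ "\<lambda>i. case i of 0 \<Rightarrow> 0 | Suc j \<Rightarrow> Suc (p j)"])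
      (auto simp: strict_mono_on_def nth_Cons split: nat.splits)
qed


lemma subseq_map_nth:
  assumes "sorted_wrt (<) ps" "\<forall>p\<in>set ps. p < length u"
  shows "subseq (map ((!) u) ps) u"
proof -
  have "subseq ps [0..<length u]"
    using assms by (intro sorted_subset_imp_subseq) auto
  then have "subseq (map ((!) u) ps) (map ((!) u) [0..<length u])"
    by (rule subseq_map)
  then show ?thesis by (simp add: map_nth)
qed

lemma regular_word_iff_nth:
  "regular_word k u \<longleftrightarrow> (\<forall>i j. i < j \<longrightarrow> j < length u \<longrightarrow> j < i + k \<longrightarrow> u ! i \<noteq> u ! j)"
proof (cases "length u < k")
  case True
  then show ?thesis
    by (auto simp: regular_word_def distinct_conv_nth) (metis linorder_neqE_nat)
next
  case False
  show ?thesis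
  proof
    assume R: "regular_word k u"
    show "\<forall>i j. i < j \<longrightarrow> j < length u \<longrightarrow> j < i + k \<longrightarrow> u ! i \<noteq> u ! j"
    proof (intro allI impI)
      fix i j assume ij: "i < j" "j < length u" "j < i + k"
      \<comment> \<open>The window starting at \<open>i\<close> may run past the end of the word; it
        is then slid left to end at the last letter, and still covers \<open>i\<close> and
        \<open>j\<close>.\<close>
      let ?s = "min i (length u - k)"
      have "distinct (take k (drop ?s u))"
        using R False by (auto simp: regular_word_def)
      then have "take k (drop ?s u) ! (i - ?s) \<noteq> take k (drop ?s u) ! (j - ?s)"
        using ij False by (subst nth_eq_iff_index_eq) (auto simp: min_def)
      then show "u ! i \<noteq> u ! j"
        using ij False by (auto simp: min_def split: if_splits)
    qed
  next
    assume *: "\<forall>i j. i < j \<longrightarrow> j < length u \<longrightarrow> j < i + k \<longrightarrow> u ! i \<noteq> u ! j"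
    have "distinct (take k (drop s u))" if "s + k \<le> length u" for s
      unfolding distinct_conv_nth
    proof (intro allI impI)
      fix i j assume "i < length (take k (drop s u))" "j < length (take k (drop s u))" "i \<noteq> j"
      then show "take k (drop s u) ! i \<noteq> take k (drop s u) ! j"
        using *[rule_format, of "s + i" "s + j"] *[rule_format, of "s + j" "s + i"] that
        by (cases "i < j") auto
    qed
    then show "regular_word k u"
      using False by (auto simp: regular_word_def)
  qed
qed

lemma word_containsD:
  assumes "word_contains u f"
  shows "\<exists>p. strict_mono_on {..<length f} p \<and> (\<forall>i<length f. p i < length u) \<and>
    (\<forall>i<length f. \<forall>j<length f. u ! p i = u ! p j \<longleftrightarrow> f ! i = f ! j)"
proof -
  obtain v where v: "subseq v u" "word_equiv v f"
    using assms by (auto simp: word_contains_def)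
  then have len: "length v = length f"
    by (simp add: word_equiv_def)
  obtain p where p: "strict_mono_on {..<length v} p" "\<forall>i<length v. p i < length u \<and> v ! i = u ! p i"
    using subseq_imp_strict_mono_index[OF v(1)] by blast
  have eq: "u ! p i = u ! p j \<longleftrightarrow> f ! i = f ! j" if "i < length f" "j < length f" for i j
    using v(2) p(2) that len unfolding word_equiv_def by auto
  show ?thesis
    using p len eq by (intro exI[of _ p]) auto
qed

text \<open>Among sufficiently many disjoint blocks of \<open>num_letters f\<close> consecutive letters, \<open>length f\<close>
  blocks use the same letters; the \<open>i\<close>-th letter of a copy of \<open>f\<close> is taken from the \<open>i\<close>-th of them.\<close>

lemma long_regular_word_contains:
  assumes reg: "regular_word (num_letters f) u" and n: "num_letters u \<le> n"
    and long: "length f * 2 ^ n * num_letters f \<le> length u"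
  shows "word_contains u f"
proof (cases "f = []")
  case True
  have "subseq [] u \<and> word_equiv [] f"
    using True by (simp add: word_equiv_def)
  then show ?thesis unfolding word_contains_def by blast
next
  case False
  define q where "q = num_letters f"
  define l where "l = length f"
  define N where "N = l * 2 ^ n"
  define S where "S b = (!) u ` {b * q..<b * q + q}" for b
  have lpos: "l > 0" using False by (simp add: l_def)
  have blk: "b * q + q \<le> length u" if "b < N" for b
  proof -
    have "Suc b * q \<le> N * q" using that by (intro mult_right_mono) auto
    then show ?thesis using long by (simp add: N_def l_def q_def)
  qed
  have cardS: "card (S b) = q" if "b < N" for b
  proof -
    have "inj_on ((!) u) {b * q..<b * q + q}"
    proof (rule linorder_inj_onI')
      fix i j assume "i \<in> {b * q..<b * q + q}" "j \<in> {b * q..<b * q + q}" "i < j"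
      then have "j < length u" "j < i + q"
        using blk[OF that] by auto
      with \<open>i < j\<close> show "u ! i \<noteq> u ! j"
        using reg unfolding regular_word_iff_nth q_def[symmetric] by blast
    qed
    then show ?thesis by (simp add: S_def card_image)
  qed
  have "S \<in> {..<N} \<rightarrow> Pow (set u)"
  proof (intro Pi_I PowI subsetI)
    fix b x assume "b \<in> {..<N}" "x \<in> S b"
    then show "x \<in> set u" using blk[of b] by (auto simp: S_def)
  qed
  \<comment> \<open>The \<open>N = l * 2 ^ n\<close> blocks have at most \<open>2 ^ n\<close> letter
    sets, so one set \<open>T\<close> serves at least \<open>l\<close> blocks.\<close>
  from pigeonhole_card[OF this] obtain T where T:
    "card (S -` {T} \<inter> {..<N}) * card (Pow (set u)) \<ge> N"
    by auto
  define I where "I = S -` {T} \<inter> {..<N}"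
  have "card (Pow (set u)) \<le> 2 ^ n"
    using n by (simp add: card_Pow num_letters_def)
  then have "card I * 2 ^ n \<ge> l * 2 ^ n"
    using T unfolding I_def N_def by (meson le_trans mult_le_mono2)
  then have lI: "l \<le> card I" by simp
  have finI: "finite I" by (simp add: I_def)
  define bl where "bl = sorted_list_of_set I"
  have lbl: "l \<le> length bl" using lI by (simp add: bl_def)
  have blI: "bl ! i \<in> I" if "i < l" for i
    using that lbl finI by (metis bl_def nth_mem order_less_le_trans set_sorted_list_of_set)
  have blmono: "bl ! i < bl ! j" if "i < j" "j < l" for i j
    using strict_sorted_list_of_set[of I] that lbl by (simp add: bl_def sorted_wrt_iff_nth_less)
  have STI: "S b = T" "b < N" if "b \<in> I" for b
    using that by (auto simp: I_def)
  \<comment> \<open>Each block has as many letters as \<open>f\<close> has distinct ones, so a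
    bijection can rename the letters of \<open>f\<close> into \<open>T\<close>.\<close>
  have "card T = card (set f)"
    using cardS[OF STI(2)[OF blI[OF lpos]]] STI(1)[OF blI[OF lpos]]
    by (simp add: q_def num_letters_def)
  moreover have "finite T"
    using STI(1)[OF blI[OF lpos]] by (auto simp: S_def)
  ultimately obtain \<pi> where \<pi>: "bij_betw \<pi> (set f) T"
    by (metis finite_same_card_bij finite_set)
  have "\<exists>p. bl ! i * q \<le> p \<and> p < bl ! i * q + q \<and> u ! p = \<pi> (f ! i)" if "i < l" for i
  proof -
    have "\<pi> (f ! i) \<in> S (bl ! i)"
      using \<pi> that STI[OF blI[OF that]] by (auto simp: l_def bij_betw_def)
    then show ?thesis by (auto simp: S_def)
  qed
  then obtain pos where pos: "\<And>i. i < l \<Longrightarrow> bl ! i * q \<le> pos i \<and> pos i < bl ! i * q + q \<and> u ! pos i = \<pi> (f ! i)"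
    by metis
  define ps where "ps = map pos [0..<l]"
  have mono: "pos i < pos j" if "i < j" "j < l" for i j
  proof -
    have "pos i < Suc (bl ! i) * q" using pos[of i] that by simp
    also have "\<dots> \<le> bl ! j * q" using blmono[OF that] by (intro mult_right_mono) auto
    also have "\<dots> \<le> pos j" using pos[of j] that by simp
    finally show ?thesis .
  qed
  have "pos i < length u" if "i < l" for i
    using pos[OF that] blk[OF STI(2)[OF blI[OF that]]] by simp
  then have "subseq (map ((!) u) ps) u"
    using mono by (intro subseq_map_nth) (auto simp: ps_def sorted_wrt_iff_nth_less)
  moreover have "word_equiv (map ((!) u) ps) f"
    using pos \<pi> by (auto simp: word_equiv_def ps_def l_def bij_betw_def inj_on_eq_iff)
  ultimately show ?thesis by (auto simp: word_contains_def)
qed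

section \<open>Bounds for the extremal function of words\<close>

lemma length_le_ex_DS:
  fixes u :: "nat list"
  assumes "regular_word (num_letters f) u" "num_letters u \<le> n" "\<not> word_contains u f"
  shows "length u \<le> ex_DS n f"
  unfolding ex_DS_def
\<comment> \<open>Finiteness, without which \<open>Max\<close> says nothing, comes from
  \<open>long_regular_word_contains\<close>.\<close>
proof (rule Max_ge)
  show "finite {length u |u :: nat list.
     regular_word (num_letters f) u \<and> num_letters u \<le> n \<and> \<not> word_contains u f}"
    by (rule finite_subset[of _ "{..<length f * 2 ^ n * num_letters f}"])
      (auto simp: not_le[symmetric] intro: long_regular_word_contains)
qed (use assms in auto)

text \<open>The witness \<open>[0..<n]\<close> has distinct letters and is shorter than
  \<open>f\<close>, which has more than \<open>n\<close> letters.\<close>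

lemma ex_DS_ge_of_few_letters:
  assumes "n < num_letters f"
  shows "n \<le> ex_DS n f"
proof -
  have "num_letters f \<le> length f"
    by (simp add: num_letters_def card_length)
  then have "\<not> word_contains [0..<n] f"
    using assms by (auto simp: word_contains_def word_equiv_def dest: list_emb_length)
  moreover have "regular_word (num_letters f) [0..<n]"
    using assms by (simp add: regular_word_def)
  ultimately show ?thesis
    using length_le_ex_DS[of f "[0..<n]" n] by (simp add: num_letters_def)
qed

text \<open>The witness repeats \<open>0, ..., n - 1\<close> cyclically \<open>r - 1\<close> times,
  so no letter occurs \<open>r\<close> times, as the initial run of \<open>f\<close> would
  require.\<close>

lemma ex_DS_ge_of_run:
  assumes n: "num_letters f \<le> n" and r: "0 < r" "r \<le> length f" and run: "\<And>i. i < r \<Longrightarrow> f ! i = a"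
  shows "n * (r - 1) \<le> ex_DS n f"
proof -
  define u where "u = map (\<lambda>i. i mod n) [0..<n * (r - 1)]"
  have apart: "i + n \<le> j" if "i < j" "i mod n = j mod n" for i j :: nat
  proof -
    have "n dvd j - i"
      using that(1) that(2)[symmetric] by (simp add: mod_eq_dvd_iff_nat)
    then show ?thesis using that by (auto dest: dvd_imp_le)
  qed
  have "regular_word (num_letters f) u"
    unfolding regular_word_iff_nth
  proof (intro allI impI notI)
    fix i j assume "i < j" "j < length u" "j < i + num_letters f" "u ! i = u ! j"
    then show False using apart[of i j] n by (simp add: u_def)
  qed
  moreover have "num_letters u \<le> n"
  proof (cases "n = 0")
    case False
    then have "set u \<subseteq> {..<n}" by (auto simp: u_def)
    then show ?thesis
      using card_mono[of "{..<n}" "set u"] by (simp add: num_letters_def)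
  qed (simp add: u_def num_letters_def)
  moreover have "\<not> word_contains u f"
  proof
    assume "word_contains u f"
    then obtain p where p0: "strict_mono_on {..<length f} p" "\<forall>i<length f. p i < length u"
      "\<forall>i<length f. \<forall>j<length f. u ! p i = u ! p j \<longleftrightarrow> f ! i = f ! j"
      using word_containsD[of u f] by blast
    note p = p0(1) p0(2)[rule_format] p0(3)[rule_format]
    \<comment> \<open>Equal letters are at least \<open>n\<close> apart, which pushes copy
      \<open>r - 1\<close> of the run beyond the end of the word.\<close>
    have "n * j \<le> p j" if "j < r" for j
      using that
    proof (induction j)
      case (Suc j)
      have "p j mod n = p (Suc j) mod n"
        using p(2)[of j] p(2)[of "Suc j"] p(3)[of j "Suc j"] run[of j] run[of "Suc j"] Suc.prems r
        by (simp add: u_def)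
      moreover have "p j < p (Suc j)"
        using p(1) Suc.prems r by (auto simp: strict_mono_on_def)
      ultimately show ?case
        using apart[of "p j" "p (Suc j)"] Suc by simp
    qed simp
    from this[of "r - 1"] have "n * (r - 1) \<le> p (r - 1)"
      using r by simp
    moreover have "p (r - 1) < n * (r - 1)"
      using p(2)[of "r - 1"] r by (simp add: u_def)
    ultimately show False by simp
  qed
  ultimately have "length u \<le> ex_DS n f" by (rule length_le_ex_DS)
  then show ?thesis by (simp add: u_def)
qed

text \<open>Positions in a word of runs are addressed as \<open>i * r + j\<close>, for copy
  \<open>j\<close> in run \<open>i\<close>.\<close>

lemma concat_replicate_nth:
  assumes "i < length w" "j < r"
  shows "concat (map (replicate r) w) ! (i * r + j) = w ! i"
  using assms
proof (induction w arbitrary: i)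
  case (Cons a w)
  then show ?case
    by (cases i) (auto simp: nth_append)
qed simp

lemma length_concat_replicate: "length (concat (map (replicate r) w)) = length w * r"
  by (induction w) auto

lemma concat_replicate_index:
  assumes "i < m" "j < (r::nat)"
  shows "i * r + j < m * r"
proof -
  have "i * r + j < Suc i * r" using assms by simp
  also have "\<dots> \<le> m * r" using assms by (intro mult_right_mono) auto
  finally show ?thesis .
qed

lemma set_concat_replicate: "0 < r \<Longrightarrow> set (concat (map (replicate r) w)) = set w"
  by auto


subsection \<open>A regular word of endpoints\<close>

text \<open>Two of \<open>k - 1\<close> consecutive letters are at most \<open>k - 2\<close>
  positions apart; writing this as \<open>j + 1 < i + k\<close> avoids truncated
  subtraction.\<close>

definition close_pairs :: "nat \<Rightarrow> 'a list \<Rightarrow> 'a set set" where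
  "close_pairs k u = {{u ! i, u ! j} | i j. i < j \<and> j < length u \<and> j + 1 < i + k}"

lemma close_pairs_append: "close_pairs k u \<subseteq> close_pairs k (u @ w)"
proof
  fix e assume "e \<in> close_pairs k u"
  then obtain i j where "e = {u ! i, u ! j}" "i < j" "j < length u" "j + 1 < i + k"
    unfolding close_pairs_def by blast
  then have "e = {(u @ w) ! i, (u @ w) ! j} \<and> i < j \<and> j < length (u @ w) \<and> j + 1 < i + k"
    by (simp add: nth_append)
  then show "e \<in> close_pairs k (u @ w)"
    unfolding close_pairs_def by blast
qed

text \<open>Each right end \<open>j\<close> leaves at most \<open>k - 2\<close> choices of the left
  end \<open>i\<close>.\<close>

lemma card_close_pairs: "finite (close_pairs k u)" "card (close_pairs k u) \<le> length u * (k - 2)"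
proof -
  let ?P = "SIGMA j:{..<length u}. {j + 2 - k..<j}"
  have eq: "close_pairs k u = (\<lambda>(j, i). {u ! i, u ! j}) ` ?P"
  proof (intro equalityI subsetI)
    fix e assume "e \<in> close_pairs k u"
    then obtain i j where "e = {u ! i, u ! j}" "i < j" "j < length u" "j + 1 < i + k"
      unfolding close_pairs_def by blast
    then show "e \<in> (\<lambda>(j, i). {u ! i, u ! j}) ` ?P"
      by (intro image_eqI[of _ _ "(j, i)"]) auto
  next
    fix e assume "e \<in> (\<lambda>(j, i). {u ! i, u ! j}) ` ?P"
    then obtain i j where "e = {u ! i, u ! j}" "j < length u" "j + 2 - k \<le> i" "i < j"
      by auto
    then have "e = {u ! i, u ! j} \<and> i < j \<and> j < length u \<and> j + 1 < i + k"
      by auto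
    then show "e \<in> close_pairs k u"
      unfolding close_pairs_def by blast
  qed
  show "finite (close_pairs k u)" unfolding eq by auto
  have "card (close_pairs k u) \<le> card ?P"
    unfolding eq by (rule card_image_le) auto
  also have "\<dots> = (\<Sum>j<length u. card {j + 2 - k..<j})"
    by simp
  also have "\<dots> \<le> (\<Sum>j<length u. k - 2)"
    by (rule sum_mono) auto
  finally show "card (close_pairs k u) \<le> length u * (k - 2)" by simp
qed

text \<open>Each letter is kept with the edge that produced it, so that a pattern found in the word
  leads back to a subsequence of the scanned edges.\<close>

lemma greedy_endpoint_word:
  assumes "\<forall>e\<in>set es. card e = 2"
  shows "\<exists>ws. subseq (map fst ws) es \<and> (\<forall>(e, v)\<in>set ws. v \<in> e) \<and> regular_word k (map snd ws) \<and>
    set es \<subseteq> fst ` set ws \<union> close_pairs k (map snd ws)"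
  using assms
proof (induction es rule: rev_induct)
  case Nil
  show ?case by (intro exI[of _ "[]"]) (simp add: regular_word_iff_nth)
next
  case (snoc e es)
  then obtain ws where ws: "subseq (map fst ws) es" "\<forall>(e, v)\<in>set ws. v \<in> e"
    "regular_word k (map snd ws)" "set es \<subseteq> fst ` set ws \<union> close_pairs k (map snd ws)"
    by auto
  define u where "u = map snd ws"
  \<comment> \<open>The letters at the last \<open>k - 1\<close> positions, or at all positions if
    there are fewer; a letter outside \<open>L\<close> can be appended without breaking
    regularity.\<close>
  define L where "L = {u ! i | i. i < length u \<and> length u < i + k}"
  show ?case
  proof (cases "e \<subseteq> L")
    case False
    then obtain v where v: "v \<in> e" "v \<notin> L" by auto
    have "regular_word k (u @ [v])"
      using ws(3) v(2) unfolding regular_word_iff_nth u_def[symmetric] L_def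
      by (auto simp: nth_append less_Suc_eq)
    moreover have "close_pairs k u \<subseteq> close_pairs k (u @ [v])"
      by (rule close_pairs_append)
    ultimately show ?thesis
      using ws v by (intro exI[of _ "ws @ [(e, v)]"]) (auto simp: u_def)
  next
    case True
    have "card e = 2" using snoc.prems by simp
    then obtain x y where e: "e = {x, y}" "x \<noteq> y"
      by (auto simp: card_2_iff)
    with True obtain i j where ij: "x = u ! i" "y = u ! j" "i < length u" "j < length u"
      "length u < i + k" "length u < j + k"
      by (auto simp: L_def)
    \<comment> \<open>The endpoints differ, so they sit at different positions among the last
      \<open>k - 1\<close>, hence at most \<open>k - 2\<close> apart.\<close>
    with e have "i < j \<or> j < i" by (metis linorder_neqE_nat)
    then have "(i < j \<and> j < length u \<and> j + 1 < i + k \<and> e = {u ! i, u ! j}) \<or>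
        (j < i \<and> i < length u \<and> i + 1 < j + k \<and> e = {u ! j, u ! i})"
      using e ij by auto
    then have "e \<in> close_pairs k u"
      unfolding close_pairs_def by blast
    then show ?thesis
      using ws by (intro exI[of _ ws]) (auto simp: u_def)
  qed
qed

text \<open>Every edge is recorded in \<open>ws\<close> or is a close pair. As subtraction
  truncates, the factor is \<open>1\<close> for \<open>k < 2\<close> and \<open>k - 1\<close>
  otherwise.\<close>

lemma greedy_endpoint_word_long:
  assumes "distinct es" "\<forall>e\<in>set es. card e = 2"
  obtains ws where "subseq (map fst ws) es" "\<forall>(e, v)\<in>set ws. v \<in> e" "regular_word k (map snd ws)"
    "length es \<le> (1 + (k - 2)) * length ws"
proof -
  obtain ws where ws: "subseq (map fst ws) es" "\<forall>(e, v)\<in>set ws. v \<in> e"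
    "regular_word k (map snd ws)" "set es \<subseteq> fst ` set ws \<union> close_pairs k (map snd ws)"
    using greedy_endpoint_word[OF assms(2)] by blast
  have "length es = card (set es)"
    using assms(1) by (simp add: distinct_card)
  also have "\<dots> \<le> card (fst ` set ws \<union> close_pairs k (map snd ws))"
    using ws(4) card_close_pairs by (intro card_mono) auto
  also have "\<dots> \<le> card (fst ` set ws) + card (close_pairs k (map snd ws))"
    by (rule card_Un_le)
  also have "\<dots> \<le> length ws + length ws * (k - 2)"
    using card_close_pairs(2)[of k "map snd ws"] card_length[of "map fst ws"]
    by (intro add_mono) auto
  finally show ?thesis
    using ws by (intro that[of ws]) (auto simp: algebra_simps)
qed


subsection \<open>Components of a star forest\<close>

lemma component_of_self [simp]: "v \<in> component_of G v"
  by (simp add: component_of_def)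

text \<open>Adjacency is symmetric, so reachability is an equivalence relation.\<close>

lemma component_of_eq:
  assumes "w \<in> component_of G v"
  shows "component_of G w = component_of G v"
proof -
  let ?R = "{(x, y). {x, y} \<in> edges G}"
  have "sym ?R" by (auto simp: sym_def insert_commute)
  then have "sym (?R\<^sup>*)" by (rule sym_rtrancl)
  moreover have "(v, w) \<in> ?R\<^sup>*" using assms by (simp add: component_of_def)
  ultimately show ?thesis
    unfolding component_of_def by (auto dest: symD intro: rtrancl_trans)
qed

lemma component_of_edge:
  assumes "{x, y} \<in> edges G"
  shows "component_of G x = component_of G y"
proof -
  have "y \<in> component_of G x"
    using assms by (auto simp: component_of_def)
  then show ?thesis by (rule component_of_eq[symmetric])
qed

text \<open>Evaluates the \<open>THE\<close> in \<open>edge_component\<close>: a component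
  containing \<open>e\<close> contains \<open>x\<close>, hence is the component of
  \<open>x\<close>.\<close>

lemma edge_component_eq:
  assumes G: "edge_ordered_graph G" and e: "e \<in> edges G" "x \<in> e"
  shows "edge_component G e = component_of G x" "e \<subseteq> component_of G x"
proof -
  have "card e = 2" "e \<subseteq> verts G"
    using G e by (auto simp: edge_ordered_graph_def)
  then obtain y where y: "e = {x, y}"
    using e(2) by (auto simp: card_2_iff)
  then have "component_of G y = component_of G x"
    using e component_of_edge[of x y G] by simp
  then show sub: "e \<subseteq> component_of G x"
    using y component_of_self[of y G] by auto
  show "edge_component G e = component_of G x"
    unfolding edge_component_def
  proof (rule the_equality)
    show "component_of G x \<in> components G \<and> e \<subseteq> component_of G x"
      using sub \<open>e \<subseteq> verts G\<close> e by (auto simp: components_def)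
    fix C assume "C \<in> components G \<and> e \<subseteq> C"
    then show "C = component_of G x"
      using e(2) by (auto simp: components_def dest: component_of_eq)
  qed
qed

text \<open>A star with one edge has two possible centres. The choice refers to \<open>v\<close>
  only through its component, so all vertices of a component get the same centre.\<close>

definition star_center :: "'v eograph \<Rightarrow> 'v \<Rightarrow> 'v" where
  "star_center F v = (SOME c. c \<in> component_of F v \<and>
     {e \<in> edges F. e \<subseteq> component_of F v} = (\<lambda>x. {c, x}) ` (component_of F v - {c}))"

context
  fixes F :: "'v eograph"
  assumes F: "edge_ordered_star_forest F"
begin

lemma forest_graph: "edge_ordered_graph F"
  using F by (simp add: edge_ordered_star_forest_def)

lemma star_center_spec:
  assumes "v \<in> verts F"
  shows "star_center F v \<in> component_of F v"
    "{e \<in> edges F. e \<subseteq> component_of F v} =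
      (\<lambda>x. {star_center F v, x}) ` (component_of F v - {star_center F v})"
proof -
  have "component_of F v \<in> components F"
    using assms by (simp add: components_def)
  then have "\<exists>c. c \<in> component_of F v \<and>
     {e \<in> edges F. e \<subseteq> component_of F v} = (\<lambda>x. {c, x}) ` (component_of F v - {c})"
    using F by (auto simp: edge_ordered_star_forest_def is_star_def)
  from someI_ex[OF this] show "star_center F v \<in> component_of F v"
    "{e \<in> edges F. e \<subseteq> component_of F v} =
      (\<lambda>x. {star_center F v, x}) ` (component_of F v - {star_center F v})"
    by (simp_all add: star_center_def)
qed

lemma star_center_cong:
  "component_of F v = component_of F w \<Longrightarrow> star_center F v = star_center F w"
  by (simp add: star_center_def)

lemma star_center_idem:
  assumes "v \<in> verts F"
  shows "star_center F (star_center F v) = star_center F v"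
  by (rule star_center_cong) (rule component_of_eq[OF star_center_spec(1)[OF assms]])

lemma leaf_edge:
  assumes "v \<in> verts F" "v \<noteq> star_center F v"
  shows "{star_center F v, v} \<in> edges F"
proof -
  have "{star_center F v, v} \<in> (\<lambda>x. {star_center F v, x}) ` (component_of F v - {star_center F v})"
    using assms(2) by (intro imageI) simp
  then show ?thesis
    unfolding star_center_spec(2)[OF assms(1), symmetric] by simp
qed

text \<open>If two such edges coincide crosswise, each of \<open>v\<close> and \<open>w\<close> is
  the centre of the other; idempotence then makes \<open>w\<close> its own centre, which the domain
  excludes.\<close>

lemma leaf_edge_inj:
  "inj_on (\<lambda>v. {star_center F v, v}) {v \<in> verts F. v \<noteq> star_center F v}"
proof (rule inj_onI)
  fix v w assume v: "v \<in> {v \<in> verts F. v \<noteq> star_center F v}" and w: "w \<in> {v \<in> verts F. v \<noteq> star_center F v}"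
    and eq: "{star_center F v, v} = {star_center F w, w}"
  show "v = w"
  proof (rule ccontr)
    assume "v \<noteq> w"
    then have *: "v = star_center F w" "w = star_center F v"
      using eq by (auto simp: doubleton_eq_iff)
    then have "star_center F v = star_center F w"
      using star_center_idem[of w] w by auto
    with *(2) have "w = star_center F w" by (rule trans)
    with w show False by simp
  qed
qed

text \<open>With \<open>leaf_edge_inj\<close>, this indexes the edges by the non-central vertices,
  so leaves can be placed edge by edge.\<close>

lemma edge_as_leaf_edge:
  assumes "e \<in> edges F"
  obtains x where "x \<in> verts F" "x \<noteq> star_center F x" "e = {star_center F x, x}"
    "edge_component F e = component_of F x"
proof -
  have "card e = 2" and sub: "e \<subseteq> verts F"
    using forest_graph assms by (auto simp: edge_ordered_graph_def)
  then obtain v where v: "v \<in> e" by fastforce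
  then have vV: "v \<in> verts F" using sub by auto
  have "e \<subseteq> component_of F v"
    by (rule edge_component_eq(2)[OF forest_graph assms v])
  then obtain x where x: "x \<in> component_of F v" "x \<noteq> star_center F v" "e = {star_center F v, x}"
    using star_center_spec(2)[OF vV] assms by blast
  have "star_center F x = star_center F v"
    by (rule star_center_cong) (rule component_of_eq[OF x(1)])
  moreover have "edge_component F e = component_of F x"
    using x(3) by (intro edge_component_eq(1)[OF forest_graph assms]) simp
  ultimately show ?thesis
    using x sub by (intro that[of x]) auto
qed

lemma finite_components: "finite (components F)"
  using forest_graph by (simp add: components_def edge_ordered_graph_def)

text \<open>Non-central vertices inject into the edges by their leaf edges, and centres into the
  components.\<close>

lemma card_verts_le: "card (verts F) \<le> card (edges F) + card (components F)"
proof -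
  let ?L = "{v \<in> verts F. v \<noteq> star_center F v}"
  let ?S = "{v \<in> verts F. v = star_center F v}"
  have fin: "finite (verts F)"
    using forest_graph by (simp add: edge_ordered_graph_def)
  have "card ?L \<le> card (edges F)"
    using leaf_edge edge_ordered_graph_finite_edges[OF forest_graph]
    by (intro card_inj_on_le[OF leaf_edge_inj]) auto
  moreover have "card ?S \<le> card (components F)"
  proof (rule card_inj_on_le[of "component_of F"])
    show "inj_on (component_of F) ?S"
    proof (rule inj_onI)
      fix v w assume vw: "v \<in> ?S" "w \<in> ?S" and "component_of F v = component_of F w"
      from this(3) have "star_center F v = star_center F w" by (rule star_center_cong)
      with vw show "v = w" by simp
    qed
  qed (auto simp: components_def fin)
  moreover have "card (verts F) \<le> card ?L + card ?S"
  proof -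
    have "verts F = ?L \<union> ?S" by blast
    then have "card (verts F) = card (?L \<union> ?S)" by simp
    also have "\<dots> \<le> card ?L + card ?S" by (rule card_Un_le)
    finally show ?thesis .
  qed
  ultimately show ?thesis by simp
qed

lemma length_edge_list: "length (edge_list F) = card (edges F)"
  using edge_list_sorted[OF forest_graph] by (metis distinct_card)

lemma length_forest_word: "length (forest_word F) = card (edges F)"
  by (simp add: forest_word_def length_edge_list)

lemma card_edges_pos: "card (edges F) > 0"
  using F edge_ordered_graph_finite_edges[OF forest_graph]
  by (auto simp: edge_ordered_star_forest_def card_gt_0_iff)

lemma set_forest_word: "set (forest_word F) \<subseteq> components F"
proof
  fix C assume "C \<in> set (forest_word F)"
  then obtain e where e: "e \<in> edges F" "C = edge_component F e"
    using edge_list_sorted(2)[OF forest_graph] by (auto simp: forest_word_def)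
  then show "C \<in> components F"
    by (metis components_def edge_as_leaf_edge imageI)
qed

text \<open>Equality may fail: an isolated vertex is a component without a letter.\<close>

lemma num_letters_forest_word'_le: "num_letters (forest_word' F) \<le> card (components F)"
proof -
  have "set (forest_word' F) = set (forest_word F)"
    unfolding forest_word'_def by (rule set_concat_replicate) (simp add: card_edges_pos)
  then show ?thesis
    unfolding num_letters_def using card_mono[OF finite_components set_forest_word] by simp
qed

end


subsection \<open>Embedding the forest\<close>

text \<open>The copy of \<open>F\<close> is its image under \<open>\<psi>\<close> with the induced
  order. Since \<open>eo_isomorphic H F\<close> asks for a map out of the copy, the isomorphism is
  the inverse \<open>\<phi>\<close>.\<close>

lemma eo_containsI:
  assumes G: "edge_ordered_graph G" and F: "edge_ordered_graph F"
    and inj: "inj_on \<psi> (verts F)" and V: "\<psi> ` verts F \<subseteq> verts G"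
    and E: "\<And>e. e \<in> edges F \<Longrightarrow> \<psi> ` e \<in> edges G"
    and ord: "\<And>e e'. e \<in> edges F \<Longrightarrow> e' \<in> edges F \<Longrightarrow>
      (\<psi> ` e, \<psi> ` e') \<in> eord G \<longleftrightarrow> (e, e') \<in> eord F"
  shows "eo_contains G F"
proof -
  define E' where "E' = (\<lambda>e. \<psi> ` e) ` edges F"
  define H where "H = \<lparr>verts = \<psi> ` verts F, edges = E', eord = Restr (eord G) E'\<rparr>"
  define \<phi> where "\<phi> = inv_into (verts F) \<psi>"
  have sub: "e \<subseteq> verts F" "card e = 2" if "e \<in> edges F" for e
    using F that by (auto simp: edge_ordered_graph_def)
  have E'G: "E' \<subseteq> edges G" using E by (auto simp: E'_def)
  have lin: "linear_order_on E' (Restr (eord G) E')"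
  proof -
    have "refl_on (edges G) (eord G)" "trans (eord G)" "antisym (eord G)" "total_on (edges G) (eord G)"
      using G by (auto simp: edge_ordered_graph_def order_on_defs)
    moreover from this have "refl_on E' (Restr (eord G) E')" "total_on E' (Restr (eord G) E')"
      using E'G by (auto simp: refl_on_def total_on_def)
    ultimately show ?thesis
      by (auto simp: order_on_defs intro: trans_Restr antisym_subset)
  qed
  have "edge_ordered_graph H"
    using lin F sub inj unfolding edge_ordered_graph_def H_def E'_def
    by (auto simp: card_image inj_on_subset)
  then have "eo_subgraph H G"
    using V E'G by (simp add: eo_subgraph_def H_def)
  moreover have "eo_isomorphic H F"
    unfolding eo_isomorphic_def
  proof (intro exI[of _ \<phi>] conjI ballI)
    show "bij_betw \<phi> (verts H) (verts F)"
      using bij_betw_inv_into[OF inj_on_imp_bij_betw[OF inj]] by (simp add: \<phi>_def H_def)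
    have cancel: "\<phi> ` \<psi> ` e = e" if "e \<in> edges F" for e
      unfolding \<phi>_def by (rule inv_into_image_cancel[OF inj sub(1)[OF that]])
    show "(\<lambda>e. \<phi> ` e) ` edges H = edges F"
      using cancel by (simp add: H_def E'_def image_image)
    fix e e' assume "e \<in> edges H" "e' \<in> edges H"
    then have "e \<in> E'" "e' \<in> E'" by (simp_all add: H_def)
    then obtain d d' where "d \<in> edges F" "d' \<in> edges F" "e = \<psi> ` d" "e' = \<psi> ` d'"
      unfolding E'_def by blast
    moreover from this have "(e, e') \<in> eord H \<longleftrightarrow> (e, e') \<in> eord G"
      by (simp add: H_def E'_def)
    ultimately show "(e, e') \<in> eord H \<longleftrightarrow> (\<phi> ` e, \<phi> ` e') \<in> eord F"
      using ord[of d d'] cancel[of d] cancel[of d'] by simp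
  qed
  ultimately show ?thesis by (auto simp: eo_contains_def)
qed

text \<open>After \<open>m\<close> representatives are chosen, at most \<open>card B + m\<close>
  elements are forbidden for the next one, fewer than its set has.\<close>

lemma greedy_distinct_representatives:
  assumes "finite B" "\<And>i. i < m \<Longrightarrow> card B + m \<le> card (Y i)"
  shows "\<exists>y. inj_on y {..<m} \<and> (\<forall>i<m. y i \<in> Y i - B)"
  using assms(2)
proof (induction m)
  case (Suc m)
  have "card B + m \<le> card (Y i)" if "i < m" for i
    using Suc.prems[of i] that by simp
  then obtain y where y: "inj_on y {..<m}" "\<forall>i<m. y i \<in> Y i - B"
    using Suc.IH by blast
  have "card (B \<union> y ` {..<m}) \<le> card B + m"
    using card_Un_le[of B "y ` {..<m}"] card_image_le[of "{..<m}" y] by simp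
  also have "\<dots> < card (Y m)" using Suc.prems[of m] by simp
  finally have "\<not> Y m \<subseteq> B \<union> y ` {..<m}"
    using card_mono[of "B \<union> y ` {..<m}" "Y m"] assms(1) by auto
  then obtain z where z: "z \<in> Y m" "z \<notin> B" "z \<notin> y ` {..<m}" by auto
  have "inj_on (y(m := z)) {..<m}"
    using y(1) by (subst inj_on_cong[of _ _ y]) auto
  moreover have "(y(m := z)) ` {..<m} = y ` {..<m}"
    by (rule image_cong) auto
  ultimately have "inj_on (y(m := z)) {..<Suc m}"
    using z by (simp add: lessThan_Suc)
  moreover have "\<forall>i<Suc m. (y(m := z)) i \<in> Y i - B"
    using y z by (auto simp: less_Suc_eq)
  ultimately show ?case by blast
qed auto

text \<open>At least as many elements of \<open>C\<close> remain free as there are elements of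
  \<open>B - A\<close> to place. This serves to place the isolated vertices of
  \<open>F\<close>.\<close>

lemma extend_injection:
  assumes "inj_on f A" "f ` A \<subseteq> C" "A \<subseteq> B" "finite B" "finite C" "card B \<le> card C"
  shows "\<exists>g. inj_on g B \<and> g ` B \<subseteq> C \<and> (\<forall>x\<in>A. g x = f x)"
proof -
  have "card (B - A) = card B - card A"
    using assms by (simp add: card_Diff_subset finite_subset)
  also have "\<dots> \<le> card C - card (f ` A)"
    using assms by (simp add: card_image)
  also have "\<dots> = card (C - f ` A)"
    using assms by (simp add: card_Diff_subset finite_subset)
  finally obtain h where h: "h ` (B - A) \<subseteq> C - f ` A" "inj_on h (B - A)"
    using card_le_inj[of "B - A" "C - f ` A"] assms by auto
  let ?g = "\<lambda>x. if x \<in> A then f x else h x"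
  have "inj_on ?g B"
  proof (rule inj_onI)
    fix x y assume xy: "x \<in> B" "y \<in> B" "?g x = ?g y"
    have "h z \<notin> f ` A" if "z \<in> B - A" for z
      using h(1) that by blast
    then show "x = y"
      using xy inj_onD[OF assms(1), of x y] inj_onD[OF h(2), of x y]
      by (cases "x \<in> A"; cases "y \<in> A") (simp_all, (metis imageI)+)
  qed
  moreover have "?g ` B \<subseteq> C" using assms(2) h by auto
  ultimately show ?thesis by (intro exI[of _ ?g]) auto
qed

text \<open>One edge is selected from each run; the runs follow the edge order of \<open>F\<close>,
  so the selection does too. The condition on vertex numbers leaves room for isolated
  vertices.\<close>

lemma forest_word_occurrence_imp_contains:
  fixes F :: "'v eograph" and G :: "'w eograph"
  assumes F: "edge_ordered_star_forest F" and G: "edge_ordered_graph G"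
    and sub: "subseq (map fst ws) (edge_list G)" and endp: "\<forall>(e, v)\<in>set ws. v \<in> e"
    and cont: "word_contains (map snd ws) (forest_word' F)"
    and card: "card (verts F) \<le> card (verts G)"
  shows "eo_contains G F"
proof -
  define m where "m = card (edges F)"
  define r where "r = 2 * m"
  define w where "w = forest_word F"
  define es where "es = edge_list F"
  define gs where "gs = edge_list G"
  note FG = forest_graph[OF F]
  have m0: "m > 0" using card_edges_pos[OF F] by (simp add: m_def)
  have lw: "length w = m" and les: "length es = m"
    by (simp_all add: w_def es_def m_def length_forest_word[OF F] length_edge_list[OF F])
  have es: "distinct es" "set es = edges F"
    using edge_list_sorted[OF FG] by (simp_all add: es_def)
  have gs: "distinct gs" "set gs = edges G"
    using edge_list_sorted[OF G] by (simp_all add: gs_def)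
  have w': "forest_word' F = concat (map (replicate r) w)"
    by (simp add: forest_word'_def r_def m_def w_def)
  have lw': "length (forest_word' F) = m * r"
    by (simp only: w' length_concat_replicate lw)
  have w'nth: "forest_word' F ! (i * r + j) = w ! i" if "i < m" "j < r" for i j
    unfolding w' using that lw by (intro concat_replicate_nth) auto
  note idx = concat_replicate_index

  \<comment> \<open>\<open>p\<close> places the letters of \<open>forest_word' F\<close> in
    \<open>ws\<close>, and \<open>t\<close> places the entries of \<open>ws\<close> in the edge list
    of \<open>G\<close>.\<close>
  obtain p where p: "strict_mono_on {..<m * r} p" "\<forall>i<m * r. p i < length ws"
    "\<forall>i<m * r. \<forall>j<m * r.
      map snd ws ! p i = map snd ws ! p j \<longleftrightarrow> forest_word' F ! i = forest_word' F ! j"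
    using word_containsD[OF cont] unfolding lw' length_map by blast
  obtain t where t: "strict_mono_on {..<length ws} t"
    "\<forall>i<length ws. t i < length gs \<and> map fst ws ! i = gs ! t i"
    using subseq_imp_strict_mono_index[OF sub] unfolding length_map gs_def by blast
  \<comment> \<open>\<open>b i\<close> is the centre read off at run \<open>i\<close>, and
    \<open>pos i j\<close> the index in \<open>gs\<close> of the edge that produced copy
    \<open>j\<close> of that run.\<close>
  define b where "b i = snd (ws ! p (i * r))" for i
  define pos where "pos i j = t (p (i * r + j))" for i j
  have r0: "r > 0" using m0 by (simp add: r_def)
  have pb: "p (i * r + j) < length ws" if "i < m" "j < r" for i j
    using p(2) idx[OF that] by blast
  have snd_ws: "snd (ws ! p (i * r + j)) = b i'  \<longleftrightarrow> w ! i = w ! i'"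
    if "i < m" "i' < m" "j < r" for i i' j
  proof -
    have "map snd ws ! p (i * r + j) = map snd ws ! p (i' * r + 0) \<longleftrightarrow>
        forest_word' F ! (i * r + j) = forest_word' F ! (i' * r + 0)"
      using p(3) idx[OF that(1,3)] idx[OF that(2) r0] by blast
    then show ?thesis
      using that r0 pb[of i j] pb[of i' 0] w'nth[of i j] w'nth[of i' 0]
      by (simp add: b_def)
  qed
  have b_eq: "b i = b i' \<longleftrightarrow> w ! i = w ! i'" if "i < m" "i' < m" for i i'
    using snd_ws[OF that r0] by (simp add: b_def)
  have posl: "pos i j < length gs" if "i < m" "j < r" for i j
    using t(2) pb[OF that] by (simp add: pos_def)
  have pos_mono: "pos i j < pos i' j'"
    if "i * r + j < i' * r + j'" "i < m" "j < r" "i' < m" "j' < r" for i j i' j'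
  proof -
    have "p (i * r + j) < p (i' * r + j')"
      using strict_mono_onD[OF p(1)] idx[OF that(2,3)] idx[OF that(4,5)] that(1) by simp
    then show ?thesis
      unfolding pos_def using strict_mono_onD[OF t(1)] pb[OF that(2,3)] pb[OF that(4,5)] by simp
  qed
  have b_in: "b i \<in> gs ! pos i j" if "i < m" "j < r" for i j
  proof -
    have "ws ! p (i * r + j) \<in> set ws" using pb[OF that] by simp
    then have "snd (ws ! p (i * r + j)) \<in> fst (ws ! p (i * r + j))"
      using endp by (auto simp: case_prod_unfold)
    moreover have "snd (ws ! p (i * r + j)) = b i"
      using snd_ws[OF that(1) that(1) that(2)] by simp
    moreover have "fst (ws ! p (i * r + j)) = gs ! pos i j"
      using t(2) pb[OF that] by (simp add: pos_def)
    ultimately show ?thesis by simp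
  qed
  have gE: "gs ! pos i j \<in> edges G" if "i < m" "j < r" for i j
    using posl[OF that] gs(2) nth_mem by blast
  have Gedge: "card e = 2" "e \<subseteq> verts G" if "e \<in> edges G" for e
    using G that by (auto simp: edge_ordered_graph_def)
  have finG: "finite (verts G)" and finF: "finite (verts F)"
    using G FG by (simp_all add: edge_ordered_graph_def)

  \<comment> \<open>The candidate leaves at run \<open>i\<close>: its \<open>r\<close> edges are
    distinct and share \<open>b i\<close>, so their other endpoints are distinct.\<close>
  define Y where "Y i = {y. \<exists>j<r. gs ! pos i j = {b i, y}}" for i
  have cardY: "r \<le> card (Y i)" if i: "i < m" for i
  proof -
    have "inj_on (\<lambda>j. gs ! pos i j) {..<r}"
    proof (rule linorder_inj_onI')
      fix j j' assume "j \<in> {..<r}" "j' \<in> {..<r}" "j < j'"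
      then show "gs ! pos i j \<noteq> gs ! pos i j'"
        using pos_mono[of i j i j'] posl[of i j] posl[of i j'] i gs(1)
        by (simp add: nth_eq_iff_index_eq)
    qed
    then have "card ((\<lambda>j. gs ! pos i j) ` {..<r}) = r"
      by (simp add: card_image)
    moreover have "(\<lambda>j. gs ! pos i j) ` {..<r} \<subseteq> (\<lambda>y. {b i, y}) ` Y i"
    proof
      fix e assume "e \<in> (\<lambda>j. gs ! pos i j) ` {..<r}"
      then obtain j where j: "j < r" "e = gs ! pos i j" by auto
      then have "card e = 2" "b i \<in> e"
        using Gedge(1)[OF gE[OF i]] b_in[OF i] by auto
      then obtain y where "e = {b i, y}"
        by (auto simp: card_2_iff)
      then show "e \<in> (\<lambda>y. {b i, y}) ` Y i"
        using j by (auto simp: Y_def)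
    qed
    moreover have "Y i \<subseteq> verts G"
      using Gedge(2)[OF gE[OF i]] by (auto simp: Y_def)
    then have "finite (Y i)" using finG by (rule finite_subset)
    ultimately show ?thesis
      using card_mono[of "(\<lambda>y. {b i, y}) ` Y i" "(\<lambda>j. gs ! pos i j) ` {..<r}"]
        card_image_le[of "Y i" "\<lambda>y. {b i, y}"] by simp
  qed
  \<comment> \<open>\<open>B\<close> collects all centres. Since \<open>r = 2 * m\<close>, each
    \<open>Y i\<close> is large enough to avoid \<open>B\<close> and all earlier leaves.\<close>
  define B where "B = b ` {..<m}"
  have "card B \<le> m"
    using card_image_le[of "{..<m}" b] by (simp add: B_def)
  then have "card B + m \<le> card (Y i)" if "i < m" for i
    using cardY[OF that] by (simp add: r_def)
  moreover have "finite B" by (simp add: B_def)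
  ultimately obtain y where y: "inj_on y {..<m}" "\<forall>i<m. y i \<in> Y i - B"
    using greedy_distinct_representatives[of B m Y] by blast
  then have "\<forall>i<m. \<exists>j<r. gs ! pos i j = {b i, y i}"
    by (auto simp: Y_def)
  then obtain J where J: "\<And>i. i < m \<Longrightarrow> J i < r" "\<And>i. i < m \<Longrightarrow> gs ! pos i (J i) = {b i, y i}"
    by metis
  \<comment> \<open>The index of the edge of \<open>G\<close> chosen for edge \<open>i\<close> of
    \<open>F\<close>. It increases with \<open>i\<close> whatever the \<open>J i\<close> are,
    because the runs are consecutive.\<close>
  define P where "P i = pos i (J i)" for i
  have P_mono: "P i < P i'" if "i < i'" "i' < m" for i i'
  proof -
    have "i * r + J i < i' * r + 0"
      using idx[OF that(1) J(1)[of i]] that by simp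
    then show ?thesis unfolding P_def using that J(1) by (intro pos_mono) auto
  qed
  have P_le: "P i \<le> P i' \<longleftrightarrow> i \<le> i'" if "i < m" "i' < m" for i i'
    using P_mono[of i i'] P_mono[of i' i] that
    by (cases i i' rule: linorder_cases) auto
  have Pl: "P i < length gs" and PE: "gs ! P i = {b i, y i}" if "i < m" for i
    using posl J that by (simp_all add: P_def)

  have ex_leaf: "\<exists>i<m. es ! i = {star_center F x, x}"
    if "x \<in> verts F" "x \<noteq> star_center F x" for x
    using leaf_edge[OF F that] es(2) les by (metis in_set_conv_nth)
  define li where "li x = (SOME i. i < m \<and> es ! i = {star_center F x, x})" for x
  have li: "li x < m" "es ! li x = {star_center F x, x}"
    if "x \<in> verts F" "x \<noteq> star_center F x" for x
    using someI_ex[OF ex_leaf[OF that]] by (simp_all add: li_def)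
  have edge: "\<exists>x. x \<in> verts F \<and> x \<noteq> star_center F x \<and> es ! i = {star_center F x, x} \<and>
      w ! i = component_of F x \<and> component_of F (star_center F x) = component_of F x \<and> li x = i"
    if "i < m" for i
  proof -
    have eE: "es ! i \<in> edges F" using that es(2) les nth_mem by blast
    obtain x where x: "x \<in> verts F" "x \<noteq> star_center F x" "es ! i = {star_center F x, x}"
      "edge_component F (es ! i) = component_of F x"
      using edge_as_leaf_edge[OF F eE] by blast
    have "w ! i = component_of F x"
      using x(4) that les by (simp add: w_def forest_word_def es_def)
    moreover have "component_of F (star_center F x) = component_of F x"
      using x(3) eE by (intro component_of_edge) simp
    moreover have "es ! li x = es ! i" using li(2)[OF x(1,2)] x(3) by simp
    then have "li x = i"
      using es(1) les that li(1)[OF x(1,2)] by (simp add: nth_eq_iff_index_eq)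
    ultimately show ?thesis using x by blast
  qed
  \<comment> \<open>Any edge index in the component of \<open>c\<close> will do, since by
    \<open>b_eq\<close> all of them yield the same centre.\<close>
  define ci where "ci c = (SOME i. i < m \<and> w ! i = component_of F c)" for c
  have ci: "ci c < m" "w ! ci c = component_of F c" if "\<exists>i<m. w ! i = component_of F c" for c
    using someI_ex[OF that] by (simp_all add: ci_def)
  \<comment> \<open>The non-isolated vertices. Only on these is \<open>\<psi>\<close> below
    meaningful, as \<open>ci\<close> has no valid choice at an isolated vertex.\<close>
  define V1 where "V1 = \<Union> (edges F)"
  have V1: "x \<in> verts F" "\<exists>i<m. w ! i = component_of F x" if x: "x \<in> V1" for x
  proof -
    obtain e where "e \<in> edges F" "x \<in> e" using x by (auto simp: V1_def)
    then obtain i where i: "i < m" "x \<in> es ! i"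
      using es(2) les by (metis in_set_conv_nth)
    show "x \<in> verts F"
      using \<open>e \<in> edges F\<close> \<open>x \<in> e\<close> FG by (auto simp: edge_ordered_graph_def)
    have "w ! i = component_of F x"
      using edge[OF i(1)] i(2) by auto
    with i show "\<exists>i<m. w ! i = component_of F x" by blast
  qed
  define \<psi> where "\<psi> x = (if x = star_center F x then b (ci x) else y (li x))" for x
  have \<psi>_edge: "\<psi> ` (es ! i) = {b i, y i}" if i: "i < m" for i
  proof -
    obtain x where x: "x \<in> verts F" "x \<noteq> star_center F x" "es ! i = {star_center F x, x}"
      "w ! i = component_of F x" "component_of F (star_center F x) = component_of F x" "li x = i"
      using edge[OF i] by blast
    have "\<exists>i<m. w ! i = component_of F (star_center F x)"
      using i x(4,5) by auto
    from ci[OF this] have "b (ci (star_center F x)) = b i"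
      using b_eq[of "ci (star_center F x)" i] i x(4,5) by simp
    then have "\<psi> (star_center F x) = b i"
      using star_center_idem[OF F x(1)] by (simp add: \<psi>_def)
    moreover have "\<psi> x = y i" using x by (simp add: \<psi>_def)
    ultimately show ?thesis using x(3) by simp
  qed
  \<comment> \<open>Centres are told apart by their components, leaves by their edges, and no leaf
    meets a centre because the \<open>y i\<close> avoid \<open>B\<close>.\<close>
  have "inj_on \<psi> V1"
  proof (rule inj_onI)
    fix x x' assume xx: "x \<in> V1" "x' \<in> V1" "\<psi> x = \<psi> x'"
    have bB: "b (ci z) \<in> B" if "z \<in> V1" for z
      using ci(1)[OF V1(2)[OF that]] by (simp add: B_def)
    have yB: "y (li z) \<notin> B" if "z \<in> V1" "z \<noteq> star_center F z" for z
      using y(2) li(1)[OF V1(1)[OF that(1)] that(2)] by auto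
    consider "x = star_center F x" "x' = star_center F x'"
      | "x \<noteq> star_center F x" "x' \<noteq> star_center F x'"
      | "(x = star_center F x) \<noteq> (x' = star_center F x')" by blast
    then show "x = x'"
    proof cases
      case 1
      then have "b (ci x) = b (ci x')" using xx(3) by (simp add: \<psi>_def)
      then have "component_of F x = component_of F x'"
        using ci[OF V1(2)[OF xx(1)]] ci[OF V1(2)[OF xx(2)]] b_eq by simp
      then have "star_center F x = star_center F x'" by (rule star_center_cong[OF F])
      with 1 show ?thesis by simp
    next
      case 2
      then have "y (li x) = y (li x')" using xx(3) by (simp add: \<psi>_def)
      then have "li x = li x'"
        using y(1) li(1)[OF V1(1)[OF xx(1)] 2(1)] li(1)[OF V1(1)[OF xx(2)] 2(2)]
        by (simp add: inj_on_eq_iff)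
      then have "{star_center F x, x} = {star_center F x', x'}"
        using li(2)[OF V1(1)[OF xx(1)] 2(1)] li(2)[OF V1(1)[OF xx(2)] 2(2)] by simp
      then show ?thesis
        using 2 V1(1) xx by (intro inj_onD[OF leaf_edge_inj[OF F]]) auto
    next
      case 3
      then show ?thesis
        using xx bB[OF xx(1)] bB[OF xx(2)] yB[OF xx(1)] yB[OF xx(2)]
        by (cases "x = star_center F x") (auto simp: \<psi>_def)
    qed
  qed
  moreover have "\<psi> ` V1 \<subseteq> verts G"
  proof
    fix z assume "z \<in> \<psi> ` V1"
    then obtain e where "e \<in> edges F" "z \<in> \<psi> ` e" by (auto simp: V1_def)
    then obtain i where i: "i < m" "z \<in> \<psi> ` (es ! i)"
      using es(2) les by (metis in_set_conv_nth)
    then have "z \<in> gs ! P i" using \<psi>_edge PE by simp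
    then show "z \<in> verts G"
      using Gedge(2)[OF gE[OF i(1) J(1)[OF i(1)]]] by (auto simp: P_def)
  qed
  moreover have "V1 \<subseteq> verts F" using V1(1) by blast
  ultimately obtain \<chi> where \<chi>: "inj_on \<chi> (verts F)" "\<chi> ` verts F \<subseteq> verts G" "\<forall>x\<in>V1. \<chi> x = \<psi> x"
    using extend_injection[of \<psi> V1 "verts G" "verts F"] finF finG card by blast
  have \<chi>_edge: "\<chi> ` (es ! i) = gs ! P i" if "i < m" for i
  proof -
    have "es ! i \<subseteq> V1" using that es(2) les by (metis V1_def Sup_upper nth_mem)
    then have "\<chi> ` (es ! i) = \<psi> ` (es ! i)"
      using \<chi>(3) by (intro image_cong) auto
    then show ?thesis using \<psi>_edge[OF that] PE[OF that] by simp
  qed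
  show ?thesis
  proof (rule eo_containsI[OF G FG \<chi>(1,2)])
    fix e assume "e \<in> edges F"
    then obtain i where i: "i < m" "e = es ! i" using es(2) les by (metis in_set_conv_nth)
    then show "\<chi> ` e \<in> edges G"
      using \<chi>_edge gs(2) Pl by (metis nth_mem)
    fix e' assume "e' \<in> edges F"
    then obtain i' where i': "i' < m" "e' = es ! i'" using es(2) les by (metis in_set_conv_nth)
    have "(\<chi> ` e, \<chi> ` e') \<in> eord G \<longleftrightarrow> P i \<le> P i'"
      using i i' \<chi>_edge edge_list_nth_order[OF G] Pl unfolding gs_def by simp
    also have "\<dots> \<longleftrightarrow> (e, e') \<in> eord F"
      using P_le[OF i(1) i'(1)] edge_list_nth_order[OF FG] i i' les unfolding es_def by simp
    finally show "(\<chi> ` e, \<chi> ` e') \<in> eord G \<longleftrightarrow> (e, e') \<in> eord F" .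
  qed
qed

section \<open>Few vertices, and the final bound\<close>

lemma card_edges_le_choose_two:
  assumes "edge_ordered_graph G"
  shows "card (edges G) \<le> card (verts G) choose 2"
proof -
  have fin: "finite (verts G)" using assms by (simp add: edge_ordered_graph_def)
  have "edges G \<subseteq> {e. e \<subseteq> verts G \<and> card e = 2}"
    using assms by (auto simp: edge_ordered_graph_def)
  moreover have "finite {e. e \<subseteq> verts G \<and> card e = 2}"
    using fin by simp
  ultimately have "card (edges G) \<le> card {e. e \<subseteq> verts G \<and> card e = 2}"
    by (rule card_mono[rotated])
  then show ?thesis
    unfolding n_subsets[OF fin] .
qed

text \<open>Covers host graphs with fewer vertices than \<open>F\<close>. Here
  \<open>n choose 2\<close> is compared with the length of a word of distinct letters or of a cyclic
  word.\<close>

lemma choose_two_le_ex_DS: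
  fixes F :: "'v eograph"
  assumes F: "edge_ordered_star_forest F" and k: "card (components F) = k" "k > 1"
    and n: "n < card (verts F)"
  shows "n choose 2 \<le> (k - 1) * ex_DS n (forest_word' F)"
proof -
  define m where "m = card (edges F)"
  let ?w = "forest_word' F"
  have m0: "m > 0" using card_edges_pos[OF F] by (simp add: m_def)
  have letters: "num_letters ?w \<le> k"
    using num_letters_forest_word'_le[OF F] k(1) by simp
  show ?thesis
  proof (cases "n < num_letters ?w")
    case True
    have "n choose 2 \<le> n * (n - 1)" by (simp add: choose_two)
    also have "\<dots> \<le> n * (k - 1)"
      using True letters by (intro mult_le_mono2) linarith
    also have "\<dots> = (k - 1) * n" by simp
    also have "\<dots> \<le> (k - 1) * ex_DS n ?w"
      using ex_DS_ge_of_few_letters[OF True] by simp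
    finally show ?thesis .
  next
    case False
    \<comment> \<open>The first run of \<open>?w\<close>, with \<open>2 * m\<close> equal letters,
      is what \<open>ex_DS_ge_of_run\<close> needs.\<close>
    have "?w ! i = forest_word F ! 0" if "i < 2 * m" for i
      using concat_replicate_nth[of 0 "forest_word F" i "2 * m"] that m0 length_forest_word[OF F]
      by (simp add: forest_word'_def m_def)
    moreover have "2 * m \<le> length ?w"
      using m0 length_forest_word[OF F]
      unfolding forest_word'_def length_concat_replicate by (simp add: m_def)
    ultimately have ge: "n * (2 * m - 1) \<le> ex_DS n ?w"
      using False m0 by (intro ex_DS_ge_of_run) auto
    \<comment> \<open>Removes truncated subtraction: what remains to check is
      \<open>a + c + 1 \<le> 2 * (a + 1) * (2 * c + 1)\<close>.\<close>
    obtain a c where ac: "k - 1 = Suc a" "m = Suc c"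
      using k m0 by (metis Suc_pred diff_is_0_eq gr0I leD not0_implies_Suc zero_less_diff)
    have "n - 1 \<le> m + k - 2"
      using n card_verts_le[OF F] k by (simp add: m_def)
    also have "\<dots> \<le> 2 * ((k - 1) * (2 * m - 1))"
      using ac by (simp add: algebra_simps)
    finally have "n * (n - 1) \<le> n * (2 * ((k - 1) * (2 * m - 1)))"
      by (rule mult_le_mono2)
    then have "n choose 2 \<le> (k - 1) * (n * (2 * m - 1))"
      by (simp add: choose_two algebra_simps)
    also have "\<dots> \<le> (k - 1) * ex_DS n ?w"
      using ge by simp
    finally show ?thesis .
  qed
qed

lemma card_edges_le_ex_DS:
  fixes F :: "'v eograph" and G :: "nat eograph"
  assumes F: "edge_ordered_star_forest F" and k: "card (components F) = k" "k > 1"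
    and G: "edge_ordered_graph G" "card (verts G) = n" "\<not> eo_contains G F"
  shows "card (edges G) \<le> (k - 1) * ex_DS n (forest_word' F)"
proof (cases "card (verts F) \<le> n")
  case False
  then show ?thesis
    using card_edges_le_choose_two[OF G(1)] choose_two_le_ex_DS[OF F k, of n] G(2) by simp
next
  case True
  let ?w = "forest_word' F"
  let ?q = "num_letters ?w"
  have letters: "?q \<le> k"
    using num_letters_forest_word'_le[OF F] k(1) by simp
  note gl = edge_list_sorted[OF G(1)]
  have two: "\<forall>e\<in>set (edge_list G). card e = 2"
    using G(1) gl(2) by (auto simp: edge_ordered_graph_def)
  obtain ws where ws: "subseq (map fst ws) (edge_list G)" "\<forall>(e, v)\<in>set ws. v \<in> e"
    "regular_word ?q (map snd ws)" "length (edge_list G) \<le> (1 + (?q - 2)) * length ws"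
    by (rule greedy_endpoint_word_long[OF gl(1) two])
  have "set (map snd ws) \<subseteq> verts G"
  proof
    fix v assume "v \<in> set (map snd ws)"
    then obtain e where ev: "(e, v) \<in> set ws" by auto
    then have "e \<in> set (map fst ws)" by force
    then have "e \<in> edges G"
      using list_emb_set[OF ws(1)] gl(2) by metis
    then have "e \<subseteq> verts G" using G(1) by (simp add: edge_ordered_graph_def)
    moreover have "v \<in> e" using ev ws(2) by auto
    ultimately show "v \<in> verts G" by blast
  qed
  moreover have "finite (verts G)" using G(1) by (simp add: edge_ordered_graph_def)
  ultimately have "num_letters (map snd ws) \<le> n"
    unfolding num_letters_def G(2)[symmetric] by (rule card_mono[rotated])
  moreover have "\<not> word_contains (map snd ws) ?w"
    using forest_word_occurrence_imp_contains[OF F G(1) ws(1,2)] True G(2,3) by auto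
  ultimately have len: "length ws \<le> ex_DS n ?w"
    using length_le_ex_DS[OF ws(3)] by simp
  have "card (edges G) = length (edge_list G)"
    using gl(1,2) by (metis distinct_card)
  also have "\<dots> \<le> (1 + (?q - 2)) * length ws" by (rule ws(4))
  \<comment> \<open>Here \<open>k > 1\<close> gives \<open>1 + (?q - 2) \<le> k - 1\<close> even if
    only one letter occurs.\<close>
  also have "\<dots> \<le> (k - 1) * ex_DS n ?w"
    using letters k(2) len by (intro mult_le_mono) auto
  finally show ?thesis .
qed

theorem theorem3p3:
  fixes F :: "'v eograph" and k n :: nat
  assumes "edge_ordered_star_forest F"
    and "card (components F) = k"
    and "k > 1"
    and "n > 0"
  shows "ex_lt n F \<le> (k - 1) * ex_DS n (forest_word' F)"
proof -
  let ?S = "{card (edges G) | G :: nat eograph.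
     edge_ordered_graph G \<and> card (verts G) = n \<and> \<not> eo_contains G F}"
  have bound: "s \<le> (k - 1) * ex_DS n (forest_word' F)" if "s \<in> ?S" for s
    using that card_edges_le_ex_DS[OF assms(1-3)] by blast
  \<comment> \<open>The uniform bound also makes the set finite.\<close>
  then have "finite ?S" by (meson atMost_iff finite_atMost finite_subset subsetI)
  moreover have "?S \<noteq> {}"
  proof -
    \<comment> \<open>The edgeless graph avoids \<open>F\<close>, which has an edge, so
      \<open>Max\<close> is taken over a non-empty set.\<close>
    define G where "G = (\<lparr>verts = {..<n}, edges = {}, eord = {}\<rparr> :: nat eograph)"
    have "edge_ordered_graph G" "card (verts G) = n"
      by (simp_all add: G_def edge_ordered_graph_def)
    moreover have "\<not> eo_contains G F"
      using assms(1)
      by (auto simp: eo_contains_def eo_subgraph_def eo_isomorphic_def G_def edge_ordered_star_forest_def)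
    ultimately show ?thesis by blast
  qed
  ultimately show ?thesis
    unfolding ex_lt_def using bound by (subst Max_le_iff) auto
qed

end
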